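(* Let $k\geq 4$ be a fixed integer. Then almost all $n$-ary trees $T(n,k)$ with $n\geq 2$ satisfy $\chi_L(T(n,k))=n+k-1$; that is, there are only finitely many integers $n\geq 2$ such that $\chi_L(T(n,k))<n+k-1$.
   Context: All graphs are simple, undirected and connected. A $k$-coloring of a graph $G$ is a map $c:V(G)\to\{1,\dots,k\}$ with $c(u)\neq c(v)$ whenever $u,v$ are adjacent. If $\Pi=\{C_1,\dots,C_k\}$ is the partition of $V(G)$ into color classes ($C_i=c^{-1}(i)$), the color code of a vertex $v$ is $c_\Pi(v)=(d(v,C_1),\dots,d(v,C_k))$, where $d(v,C_i)=\min\{d(v,x):x\in C_i\}$ and $d$ is the graph distance. The coloring $c$ is a locating $k$-coloring if all vertices of $G$ have distinct color codes. The locating-chromatic number $\chi_L(G)$ is the smallest $k$ such that $G$ has a locating $k$-coloring. For integers $n\geq 2$, $k\geq 1$, the $k$-level $n$-ary tree $T(n,k)$ is defined recursively: $T(n,1)$ is the star $K_{1,n}$ (a center vertex joined to $n$ leaves), and for $k\geq 2$, $T(n,k)$ is obtained from $n$ disjoint copies of $T(n,k-1)$ by adding a new vertex adjacent to the center of each copy; this new vertex is the center of $T(n,k)$. *)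

theory Defs
  imports Main "HOL-Library.Extended_Nat"
begin

record 'a ugraph =
  verts :: "'a set"
  edges :: "'a set set"

definition adj :: "'a ugraph \<Rightarrow> 'a \<Rightarrow> 'a \<Rightarrow> bool" where
  "adj G u v \<longleftrightarrow> {u, v} \<in> edges G"

definition simple_graph :: "'a ugraph \<Rightarrow> bool" where
  "simple_graph G \<longleftrightarrow> (\<forall>e \<in> edges G. e \<subseteq> verts G \<and> card e = 2)"

text \<open>\<open>(adj G ^^ l) u v\<close> says that there is a walk of length \<open>l\<close> from \<open>u\<close> to \<open>v\<close>.\<close>

definition connected_graph :: "'a ugraph \<Rightarrow> bool" where
  "connected_graph G \<longleftrightarrow>
     verts G \<noteq> {} \<and> (\<forall>u \<in> verts G. \<forall>v \<in> verts G. \<exists>l. (adj G ^^ l) u v)"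

definition gdist :: "'a ugraph \<Rightarrow> 'a \<Rightarrow> 'a \<Rightarrow> enat" where
  "gdist G u v = (INF l \<in> {l. (adj G ^^ l) u v}. enat l)"

text \<open>The infimum of a nonempty set of extended naturals is attained, so it is the minimum.
  The distance to the empty set is \<open>\<infinity>\<close> for every vertex.\<close>

definition gdist_set :: "'a ugraph \<Rightarrow> 'a \<Rightarrow> 'a set \<Rightarrow> enat" where
  "gdist_set G v C = (INF x \<in> C. gdist G v x)"

definition proper_coloring :: "'a ugraph \<Rightarrow> nat \<Rightarrow> ('a \<Rightarrow> nat) \<Rightarrow> bool" where
  "proper_coloring G k c \<longleftrightarrow>
     c ` verts G \<subseteq> {1..k} \<and>
     (\<forall>u \<in> verts G. \<forall>v \<in> verts G. adj G u v \<longrightarrow> c u \<noteq> c v)"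

definition color_class :: "'a ugraph \<Rightarrow> ('a \<Rightarrow> nat) \<Rightarrow> nat \<Rightarrow> 'a set" where
  "color_class G c i = {v \<in> verts G. c v = i}"

definition color_code :: "'a ugraph \<Rightarrow> nat \<Rightarrow> ('a \<Rightarrow> nat) \<Rightarrow> 'a \<Rightarrow> enat list" where
  "color_code G k c v = map (\<lambda>i. gdist_set G v (color_class G c i)) [1..<Suc k]"

text \<open>Colors may be unused: an unused color contributes the entry \<open>\<infinity>\<close> to every color code
  and so never separates two vertices. Discarding it leaves a locating coloring with fewer
  colors, so the minimum below is the same whether or not all classes must be nonempty.\<close>

definition locating_coloring :: "'a ugraph \<Rightarrow> nat \<Rightarrow> ('a \<Rightarrow> nat) \<Rightarrow> bool" where
  "locating_coloring G k c \<longleftrightarrow> proper_coloring G k c \<and> inj_on (color_code G k c) (verts G)"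

definition locating_chromatic_number :: "'a ugraph \<Rightarrow> nat"  ("\<chi>\<^sub>L") where
  "\<chi>\<^sub>L G = (LEAST k. \<exists>c. locating_coloring G k c)"

lemma gdist_eq_0_iff: "gdist G u v = 0 \<longleftrightarrow> u = v"
proof
  assume "gdist G u v = 0"
  then have *: "Inf (enat ` {l. (adj G ^^ l) u v}) = 0"
    by (simp add: gdist_def)
  then have "enat ` {l. (adj G ^^ l) u v} \<noteq> {}"
    by (auto simp: Inf_enat_def split: if_splits)
  then have "Inf (enat ` {l. (adj G ^^ l) u v}) \<in> enat ` {l. (adj G ^^ l) u v}"
    by (metis Inf_enat_def LeastI ex_in_conv)
  with * have "(adj G ^^ 0) u v"
    by (auto simp: zero_enat_def)
  then show "u = v" by simp
next
  assume "u = v"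
  then have "(adj G ^^ 0) u v" by simp
  then have "gdist G u v \<le> enat 0"
    unfolding gdist_def by (intro INF_lower) simp
  then show "gdist G u v = 0" by (simp flip: zero_enat_def)
qed

lemma locating_coloring_exists:
  assumes "finite (verts G)" and "simple_graph G"
  shows "\<exists>k c. locating_coloring G k c"
proof -
  from assms(1) obtain c where c: "bij_betw c (verts G) {1..card (verts G)}"
    using finite_same_card_bij[of "verts G" "{1..card (verts G)}"] by auto
  let ?k = "card (verts G)"
  have "c u \<noteq> c v" if "u \<in> verts G" "v \<in> verts G" "adj G u v" for u v
  proof -
    from that(3) assms(2) have "card {u, v} = 2"
      by (auto simp: adj_def simple_graph_def)
    then have "u \<noteq> v" by auto
    with that c show ?thesis by (auto simp: bij_betw_def inj_on_def)
  qed
  with c have "proper_coloring G ?k c"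
    by (auto simp: proper_coloring_def bij_betw_def)
  moreover have "inj_on (color_code G ?k c) (verts G)"
  proof (rule inj_onI)
    fix u v assume uv: "u \<in> verts G" "v \<in> verts G"
      and eq: "color_code G ?k c u = color_code G ?k c v"
    from uv(1) c have "c u \<in> {1..?k}"
      using bij_betwE by blast
    then have "c u \<in> set [1..<Suc ?k]"
      by auto
    with eq have "gdist_set G u (color_class G c (c u)) = gdist_set G v (color_class G c (c u))"
      unfolding color_code_def by (metis map_eq_conv)
    moreover have "color_class G c (c u) = {u}"
      using uv c by (auto simp: color_class_def bij_betw_def inj_on_def)
    ultimately have "gdist G v u = gdist G u u"
      by (simp add: gdist_set_def)
    then show "u = v"
      by (metis gdist_eq_0_iff)
  qed
  ultimately show ?thesis
    by (auto simp: locating_coloring_def)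
qed

text \<open>Vertices of the trees are words over \<open>{..<n}\<close>. The center is always the empty word, and
  the \<open>i\<close>-th of \<open>n\<close> disjoint copies of a graph on words is obtained by prefixing every
  vertex with \<open>i\<close>, so that its center becomes \<open>[i]\<close>.\<close>

definition star :: "nat \<Rightarrow> nat list ugraph" where
  "star n = \<lparr> verts = insert [] ((\<lambda>i. [i]) ` {..<n}),
              edges = (\<lambda>i. {[], [i]}) ` {..<n} \<rparr>"

definition join_copies :: "nat \<Rightarrow> nat list ugraph \<Rightarrow> nat list ugraph" where
  "join_copies n G =
     \<lparr> verts = insert [] (\<Union>i<n. (#) i ` verts G),
       edges = (\<lambda>i. {[], [i]}) ` {..<n} \<union> (\<Union>i<n. (`) ((#) i) ` edges G) \<rparr>"

text \<open>The value at level \<open>0\<close> is only a convention to make the function total.\<close>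

fun nary_tree :: "nat \<Rightarrow> nat \<Rightarrow> nat list ugraph" where
  "nary_tree n 0 = \<lparr> verts = {[]}, edges = {} \<rparr>"
| "nary_tree n (Suc 0) = star n"
| "nary_tree n (Suc (Suc k)) = join_copies n (nary_tree n (Suc k))"

lemma nary_tree_Suc: "nary_tree n (Suc k) = join_copies n (nary_tree n k)"
  by (cases k) (auto simp: star_def join_copies_def)

lemma finite_verts_nary_tree: "finite (verts (nary_tree n k))"
  by (induction k) (simp_all add: nary_tree_Suc join_copies_def del: nary_tree.simps(2,3))

lemma Nil_in_nary_tree: "[] \<in> verts (nary_tree n k)"
  by (cases k) (simp_all add: nary_tree_Suc join_copies_def del: nary_tree.simps(2,3))

lemma simple_graph_nary_tree: "simple_graph (nary_tree n k)"
proof (induction k)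
  case 0
  then show ?case by (simp add: simple_graph_def)
next
  case (Suc k)
  show ?case
    unfolding simple_graph_def
  proof
    fix e assume "e \<in> edges (nary_tree n (Suc k))"
    then consider i where "i < n" "e = {[], [i]}"
      | i e' where "i < n" "e' \<in> edges (nary_tree n k)" "e = (#) i ` e'"
      by (auto simp: nary_tree_Suc join_copies_def simp del: nary_tree.simps(2,3))
    then show "e \<subseteq> verts (nary_tree n (Suc k)) \<and> card e = 2"
    proof cases
      case 1
      then show ?thesis
        using Nil_in_nary_tree[of n k]
        by (auto simp: nary_tree_Suc join_copies_def simp del: nary_tree.simps(2,3))
    next
      case 2
      with Suc have "e' \<subseteq> verts (nary_tree n k)" "card e' = 2"
        by (auto simp: simple_graph_def)
      moreover have "card e = card e'"
        unfolding 2(3) by (rule card_image) simp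
      ultimately show ?thesis
        using 2 by (auto simp: nary_tree_Suc join_copies_def simp del: nary_tree.simps(2,3))
    qed
  qed
qed

lemma adj_sym: "adj G u v \<Longrightarrow> adj G v u"
  by (simp add: adj_def insert_commute)

lemma connected_graph_nary_tree: "connected_graph (nary_tree n k)"
proof -
  have adj_copy: "adj (nary_tree n (Suc k)) (i # u) (i # v)"
    if "adj (nary_tree n k) u v" "i < n" for k i u v
  proof -
    have "{i # u, i # v} = (#) i ` {u, v}"
      by simp
    with that have "{i # u, i # v} \<in> (`) ((#) i) ` edges (nary_tree n k)"
      unfolding adj_def by blast
    with that(2) show ?thesis
      by (auto simp: adj_def nary_tree_Suc join_copies_def)
  qed
  have adj_root: "adj (nary_tree n (Suc k)) [] [i]" if "i < n" for k i
    using that by (auto simp: adj_def nary_tree_Suc join_copies_def)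
  have from_root: "(adj (nary_tree n k))\<^sup>*\<^sup>* [] v" if "v \<in> verts (nary_tree n k)" for v k
    using that
  proof (induction k arbitrary: v)
    case 0
    then show ?case by simp
  next
    case (Suc k)
    show ?case
    proof (cases v)
      case Nil
      then show ?thesis by simp
    next
      case (Cons i w)
      with Suc.prems have i: "i < n" and w: "w \<in> verts (nary_tree n k)"
        by (auto simp: nary_tree_Suc join_copies_def)
      have "(adj (nary_tree n (Suc k)))\<^sup>*\<^sup>* [i] (i # w)"
        using Suc.IH[OF w]
        by (induction rule: rtranclp_induct) (auto intro: rtranclp.rtrancl_into_rtrancl adj_copy i)
      with adj_root[OF i] show ?thesis
        unfolding Cons by (rule converse_rtranclp_into_rtranclp)
    qed
  qed
  have "symp (adj (nary_tree n k))"
    by (auto intro: sympI adj_sym)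
  then have "symp (adj (nary_tree n k))\<^sup>*\<^sup>*"
    by (rule symp_rtranclp)
  then show ?thesis
    using from_root Nil_in_nary_tree[of n k]
    unfolding connected_graph_def rtranclp_power[symmetric]
    by (blast intro: rtranclp_trans dest: sympD)
qed

end

theory Submission imports Defs begin

text \<open>Lower bound: a vertex \<open>p\<close> of depth \<open>k - 1\<close> has \<open>n\<close> leaf children, which must have distinct
  colors. With \<open>n + k - 2\<close> colors at most \<open>k - 2\<close> entries of the code of \<open>p\<close> differ from \<open>1\<close>, and
  all entries are bounded by the diameter \<open>2 k\<close>, so only \<open>O(n ^ (k - 2))\<close> codes are available for
  \<open>n ^ (k - 1)\<close> vertices.

  Upper bound: a root path of length \<open>k - 2\<close> picks one color after the other as missing from
  the whole subtree below. The inner vertices alternate between two extra colors, and the children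
  of depth \<open>k - 1\<close> and their leaves use up exactly the remaining colors. The later a missing color
  was picked, the closer it is, so its distance reveals its position on the path; hence the
  code determines the vertex.\<close>

declare nary_tree.simps(2,3) [simp del]

section \<open>The trees described by words\<close>

lemma verts_nary_tree: "verts (nary_tree n k) = {w. length w \<le> k \<and> set w \<subseteq> {..<n}}"
proof (induction k)
  case (Suc k)
  have "w \<in> verts (nary_tree n (Suc k)) \<longleftrightarrow> length w \<le> Suc k \<and> set w \<subseteq> {..<n}" for w
    using Suc.IH by (cases w) (auto simp: nary_tree_Suc join_copies_def)
  then show ?case by blast
qed auto

text \<open>The recursion prefixes letters at the center. Unrolled, every edge appends one letter at
  the far end, so that the parent of a vertex is its \<open>butlast\<close>.\<close>

lemma edges_nary_tree:
  "edges (nary_tree n k) = {{w, w @ [i]} | w i. length w < k \<and> set w \<subseteq> {..<n} \<and> i < n}"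
proof (induction k)
  case (Suc k)
  show ?case (is "_ = ?R")
  proof (intro subset_antisym subsetI)
    fix e assume "e \<in> edges (nary_tree n (Suc k))"
    then consider i where "i < n" "e = {[], [i]}"
      | i e' where "i < n" "e' \<in> edges (nary_tree n k)" "e = (#) i ` e'"
      by (auto simp: nary_tree_Suc join_copies_def)
    then show "e \<in> ?R"
    proof cases
      case 1
      then show ?thesis by (intro CollectI exI[of _ "[]"] exI[of _ i]) auto
    next
      case 2
      with Suc.IH obtain w j where "e' = {w, w @ [j]}" "length w < k" "set w \<subseteq> {..<n}" "j < n"
        by auto
      with 2 show ?thesis by (intro CollectI exI[of _ "i # w"] exI[of _ j]) auto
    qed
  next
    fix e assume "e \<in> ?R"
    then obtain w j where e: "e = {w, w @ [j]}" "length w < Suc k" "set w \<subseteq> {..<n}" "j < n"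
      by auto
    show "e \<in> edges (nary_tree n (Suc k))"
    proof (cases w)
      case Nil
      with e show ?thesis
        by (auto simp: nary_tree_Suc join_copies_def)
    next
      case (Cons i u)
      with e Suc.IH have "{u, u @ [j]} \<in> edges (nary_tree n k)" by auto
      moreover have "e = (#) i ` {u, u @ [j]}" using e Cons by simp
      ultimately have "e \<in> (`) ((#) i) ` edges (nary_tree n k)" by blast
      then have "e \<in> (\<Union>i<n. (`) ((#) i) ` edges (nary_tree n k))" using e Cons by auto
      then show ?thesis
        by (auto simp: nary_tree_Suc join_copies_def)
    qed
  qed
qed simp

lemma adj_nary_tree:
  "adj (nary_tree n k) u v \<longleftrightarrow>
     u \<in> verts (nary_tree n k) \<and> v \<in> verts (nary_tree n k) \<and> (\<exists>x. v = u @ [x] \<or> u = v @ [x])"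
proof
  assume "u \<in> verts (nary_tree n k) \<and> v \<in> verts (nary_tree n k) \<and> (\<exists>x. v = u @ [x] \<or> u = v @ [x])"
  then obtain x where "v = u @ [x] \<or> u = v @ [x]" "u \<in> verts (nary_tree n k)" "v \<in> verts (nary_tree n k)"
    by blast
  \<comment> \<open>The longer of the two words is the child; its \<open>butlast\<close> is the
    other endpoint.\<close>
  then have "\<exists>w i. {u, v} = {w, w @ [i]} \<and> length w < k \<and> set w \<subseteq> {..<n} \<and> i < n"
    by (elim disjE; intro exI[of _ "butlast (if length u < length v then v else u)"] exI[of _ x])
      (auto simp: verts_nary_tree)
  then show "adj (nary_tree n k) u v" unfolding adj_def edges_nary_tree by blast
qed (auto simp: adj_def edges_nary_tree verts_nary_tree doubleton_eq_iff)

section \<open>Distances to color classes and codes\<close>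

lemma gdist_le: "(adj G ^^ l) u v \<Longrightarrow> gdist G u v \<le> enat l"
  unfolding gdist_def by (rule INF_lower) simp

text \<open>Descending steps lead from \<open>v\<close> into \<open>C\<close> after
  \<open>f v\<close> steps, and since \<open>f\<close> drops by at most one per step, no walk into
  \<open>C\<close> is shorter. A guessed distance function can thus be verified edge by
  edge.\<close>

lemma gdist_set_eqI:
  fixes f :: "'a \<Rightarrow> nat"
  assumes closed: "\<And>u v. adj G u v \<Longrightarrow> u \<in> V \<and> v \<in> V"
    and zero: "\<And>v. v \<in> V \<Longrightarrow> f v = 0 \<longleftrightarrow> v \<in> C"
    and C: "C \<subseteq> V"
    and lipschitz: "\<And>u v. adj G u v \<Longrightarrow> f u \<le> f v + 1"
    and descent: "\<And>v. v \<in> V \<Longrightarrow> f v > 0 \<Longrightarrow> \<exists>u. adj G v u \<and> f v = f u + 1"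
    and v: "v \<in> V"
  shows "gdist_set G v C = enat (f v)"
proof (rule antisym)
  have "\<exists>x \<in> C. (adj G ^^ f v) v x" using v
  proof (induction "f v" arbitrary: v)
    case 0
    then have "f v = 0" "v \<in> C" using zero by auto
    then show ?case by (intro bexI[of _ v]) auto
  next
    case (Suc m)
    then obtain u where u: "adj G v u" "f v = f u + 1"
      using descent by (metis zero_less_Suc)
    then obtain x where "x \<in> C" "(adj G ^^ f u) u x"
      using Suc closed by (metis add_right_cancel Suc_eq_plus1)
    with u show ?case by (metis Suc_eq_plus1 relpowp_Suc_I2)
  qed
  then show "gdist_set G v C \<le> enat (f v)"
    unfolding gdist_set_def by (metis INF_lower2 gdist_le)
next
  have walk: "f u \<le> f x + l" if "(adj G ^^ l) u x" for l u x
    using that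
  proof (induction l arbitrary: u)
    case (Suc l)
    then obtain w where "adj G u w" "(adj G ^^ l) w x" by (metis relpowp_Suc_D2)
    with Suc.IH lipschitz show ?case by fastforce
  qed simp
  show "enat (f v) \<le> gdist_set G v C"
    unfolding gdist_set_def gdist_def using walk zero C by (fastforce intro!: INF_greatest)
qed

lemma color_code_eq_iff:
  "color_code G k c u = color_code G k c v \<longleftrightarrow>
     (\<forall>i \<in> {1..k}. gdist_set G u (color_class G c i) = gdist_set G v (color_class G c i))"
  unfolding color_code_def by (auto simp: map_eq_conv simp del: upt_Suc)

text \<open>Further colors only refine the codes. A lower bound for the number of colors therefore
  has to exclude just one value.\<close>

lemma locating_coloring_mono:
  assumes "locating_coloring G k c" "k \<le> l"
  shows "locating_coloring G l c"
proof -
  have "{1..k} \<subseteq> {1..l}" using assms(2) by auto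
  then have "color_code G k c u = color_code G k c v" if "color_code G l c u = color_code G l c v" for u v
    using that unfolding color_code_eq_iff by blast
  moreover have "proper_coloring G l c"
    using assms(1) \<open>{1..k} \<subseteq> {1..l}\<close>
    unfolding locating_coloring_def proper_coloring_def by (blast intro: subset_trans)
  ultimately show ?thesis using assms(1) unfolding locating_coloring_def inj_on_def by blast
qed

section \<open>The coloring with \<open>n + k - 1\<close> colors\<close>

text \<open>Here \<open>d = k - 2\<close>, and a vertex is represented by its reversed word, so that its parent
  is the tail. The depths up to \<open>d\<close> are inner, and \<open>avail r\<close> lists the colors (other than the two
  extra ones) that are not missing below \<open>r\<close>.\<close>

locale level_tree =
  fixes n d :: nat
  assumes n2: "n \<ge> 2"
begin

definition alpha :: nat where "alpha = n + d + 1"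
definition beta :: nat where "beta = n + d"

primrec avail :: "nat list \<Rightarrow> nat list" where
  "avail [] = [1..<n + d]"
| "avail (x # r) = remove1 (avail r ! x) (avail r)"

text \<open>Colors below \<open>n + d\<close> occur only from depth \<open>d + 1\<close> on. One
  that is available below a vertex is met straight down at that depth; a missing one is reached
  through the parent. At the center all of \<open>{1..<n + d}\<close> are available.\<close>

primrec inner_dist :: "nat list \<Rightarrow> nat \<Rightarrow> nat" where
  "inner_dist [] g = d + 1"
| "inner_dist (x # r) g = (if g \<in> set (avail (x # r)) then d - length r else Suc (inner_dist r g))"

text \<open>At depth \<open>d\<close> exactly \<open>n - 1\<close> colors are still available;
  \<open>beta\<close> completes them to one color per child.\<close>

definition pre_colors :: "nat list \<Rightarrow> nat list" where
  "pre_colors r = avail r @ [beta]"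

text \<open>The leaves below a vertex trade its own color for \<open>alpha\<close>, which again
  makes \<open>n\<close> colors. So the vertex sees all the other \<open>pre_colors\<close> at
  distance 1.\<close>

definition leaf_colors :: "nat list \<Rightarrow> nat \<Rightarrow> nat list" where
  "leaf_colors r x = remove1 (pre_colors r ! x) (pre_colors r) @ [alpha]"

text \<open>The parity is counted from depth \<open>d\<close> upwards, so that all of depth
  \<open>d\<close> is colored \<open>alpha\<close>. This frees \<open>beta\<close> for depth
  \<open>d + 1\<close> and \<open>alpha\<close> for the leaves.\<close>

definition col :: "nat list \<Rightarrow> nat" where
  "col r = (if length r \<le> d then (if even (d - length r) then alpha else beta)
     else if length r = Suc d then pre_colors (tl r) ! hd r
     else leaf_colors (tl (tl r)) (hd (tl r)) ! hd r)"

text \<open>Closed forms for the distance to the color class of \<open>g\<close>; \<open>inner_dist\<close> is its restriction to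
  inner vertices and to colors other than \<open>alpha\<close> and \<open>beta\<close>.\<close>

definition cdist :: "nat list \<Rightarrow> nat \<Rightarrow> nat" where
  "cdist r g = (if length r \<le> d then
       (if g = alpha then (if even (d - length r) then 0 else 1)
        else if g = beta then (if even (d - length r) then 1 else 0) else inner_dist r g)
     else if length r = Suc d then
       (if g = col r then 0 else if g = alpha \<or> g \<in> set (pre_colors (tl r)) then 1
        else Suc (inner_dist (tl r) g))
     else (if g = col r then 0 else if g = col (tl r) then 1
       else if g = alpha \<or> g \<in> set (pre_colors (tl (tl r))) then 2 else Suc (Suc (inner_dist (tl (tl r)) g))))"

abbreviation "valid r \<equiv> set r \<subseteq> {..<n}"

section \<open>Available colors and inner distances\<close>

lemma avail_props:
  assumes "valid r" "length r \<le> d"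
  shows "distinct (avail r)" "length (avail r) = n + d - 1 - length r" "set (avail r) \<subseteq> {1..<n + d}"
proof -
  have "distinct (avail r) \<and> length (avail r) = n + d - 1 - length r \<and> set (avail r) \<subseteq> {1..<n + d}"
    using assms
  proof (induction r)
    case (Cons x r)
    then have IH: "distinct (avail r)" "length (avail r) = n + d - 1 - length r" "set (avail r) \<subseteq> {1..<n + d}"
      by auto
    moreover have "x < length (avail r)" using Cons.prems IH by auto
    ultimately show ?case
      by (auto simp: length_remove1)
  qed auto
  then show "distinct (avail r)" "length (avail r) = n + d - 1 - length r" "set (avail r) \<subseteq> {1..<n + d}"
    by auto
qed

text \<open>Before depth \<open>d\<close> at least \<open>n\<close> colors remain, so each of the
  \<open>n\<close> child indices picks one; as \<open>avail r\<close> is distinct, removing one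
  occurrence removes the color.\<close>

lemma nth_avail:
  assumes "valid r" "length r < d" "x < n"
  shows "x < length (avail r)" "avail r ! x \<in> set (avail r)" "set (avail (x # r)) = set (avail r) - {avail r ! x}"
  using avail_props[of r] assms by auto

lemma inner_dist_ge: "length r \<le> d \<Longrightarrow> inner_dist r g \<ge> d + 1 - length r"
  by (induction r) auto

lemma inner_dist_avail: "length r \<le> d \<Longrightarrow> g \<in> set (avail r) \<Longrightarrow> inner_dist r g = d + 1 - length r"
  by (cases r) auto

text \<open>A missing color costs at least one step up and one extra step down. The resulting gap of
  two separates missing colors from available ones.\<close>

lemma inner_dist_not_avail: "length r \<le> d \<Longrightarrow> g \<notin> set (avail r) \<Longrightarrow> g \<in> {1..<n + d} \<Longrightarrow> inner_dist r g \<ge> d + 3 - length r"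
proof (induction r)
  case (Cons x r)
  then show ?case using inner_dist_ge[of r g] by auto
qed auto

lemma inner_dist_lipschitz:
  assumes "valid (x # r)" "length r < d"
  shows "inner_dist (x # r) g \<le> inner_dist r g + 1" "inner_dist r g \<le> inner_dist (x # r) g + 1"
proof -
  have "set (avail (x # r)) \<subseteq> set (avail r)" using nth_avail[of r x] assms by auto
  then show "inner_dist (x # r) g \<le> inner_dist r g + 1" "inner_dist r g \<le> inner_dist (x # r) g + 1"
    using inner_dist_ge[of r g] inner_dist_avail[of r g] assms by auto
qed

text \<open>The color picked at the last step is still available at the parent, hence one step up
  and then straight down. Colors picked earlier are at least two steps farther.\<close>

lemma inner_dist_label_iff:
  assumes "valid r" "x < n" "length r < d" "g \<in> {1..<n + d}"
  shows "g = avail r ! x \<longleftrightarrow> inner_dist (x # r) g = d + 2 - length r"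
proof (cases "g \<in> set (avail (x # r))")
  case True
  then show ?thesis using nth_avail[OF assms(1,3,2)] assms by auto
next
  case False
  then have h: "inner_dist (x # r) g = Suc (inner_dist r g)" by simp
  show ?thesis
  proof (cases "g \<in> set (avail r)")
    case True
    then show ?thesis using False h nth_avail[OF assms(1,3,2)] inner_dist_avail[of r g] assms by auto
  next
    case False
    then show ?thesis using h nth_avail[OF assms(1,3,2)] inner_dist_not_avail[of r g] assms by auto
  qed
qed

text \<open>The distances expose the last picked color; undoing that step yields the distances of
  the parent, so induction recovers the whole path.\<close>

lemma inner_dist_inj:
  assumes "valid r" "valid s" "length r = length s" "length r \<le> d"
    and "\<And>g. g \<in> {1..<n + d} \<Longrightarrow> inner_dist r g = inner_dist s g"
  shows "r = s"
  using assms
proof (induction r arbitrary: s)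
  case (Cons x r)
  then obtain y t where s: "s = y # t" by (cases s) auto
  have len: "length t = length r" "length r < d" using Cons.prems s by auto
  have v: "valid r" "valid t" "x < n" "y < n" using Cons.prems s by auto
  note X = nth_avail[OF v(1) len(2) v(3)] and Y = nth_avail[of t y]
  have in_iff: "g \<in> set (avail (x # r)) \<longleftrightarrow> g \<in> set (avail s)" if "g \<in> {1..<n + d}" for g
    using inner_dist_not_avail[of "x # r" g] inner_dist_not_avail[of s g] inner_dist_avail[of "x # r" g] inner_dist_avail[of s g]
      Cons.prems(5)[OF that] that s len
    by (cases "g \<in> set (avail (x # r))"; cases "g \<in> set (avail s)") (auto simp del: inner_dist.simps avail.simps)
  have sub: "set (avail r) \<subseteq> {1..<n + d}" "set (avail t) \<subseteq> {1..<n + d}"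
    using avail_props v len by auto
  have eq: "g = avail r ! x \<longleftrightarrow> g = avail t ! y" if "g \<in> {1..<n + d}" for g
    using inner_dist_label_iff[of r x g] inner_dist_label_iff[of t y g] Cons.prems(5)[OF that] s len v that
    by (simp del: inner_dist.simps)
  have xy: "avail r ! x = avail t ! y" using eq X sub by blast
  \<comment> \<open>A color available at the children is available at both parents, at a distance
    fixed by the depth. For a missing one, both parents are one step closer.\<close>
  have "inner_dist r g = inner_dist t g" if g: "g \<in> {1..<n + d}" for g
  proof (cases "g \<in> set (avail (x # r))")
    case True
    then have "g \<in> set (avail r)" "g \<in> set (avail t)"
      using in_iff[OF g] X Y s v len by auto
    then show ?thesis using inner_dist_avail len by auto
  next
    case False
    then show ?thesis using in_iff[OF g] Cons.prems(5)[OF g] s by (auto split: if_splits)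
  qed
  then have "r = t" using Cons.IH[of t] v len by simp
  moreover have "x = y"
  proof (rule nth_eq_iff_index_eq[THEN iffD1])
    show "distinct (avail r)" using avail_props(1)[of r] v len by simp
    show "y < length (avail r)" using nth_avail(1)[of r y] v len by simp
    show "avail r ! x = avail r ! y" using xy \<open>r = t\<close> by simp
  qed (fact X(1))
  ultimately show ?case using s by simp
qed auto

section \<open>Colors of the two lowest levels\<close>

lemma pre_colors_props:
  assumes "valid r" "length r = d"
  shows "distinct (pre_colors r)" "length (pre_colors r) = n" "set (pre_colors r) = insert beta (set (avail r))"
    "beta \<notin> set (avail r)" "alpha \<notin> set (avail r)" "alpha \<noteq> beta"
  using avail_props[of r] assms n2 by (auto simp: pre_colors_def beta_def alpha_def)

lemma leaf_colors_props:
  assumes "valid r" "length r = d" "x < n"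
  shows "distinct (leaf_colors r x)" "length (leaf_colors r x) = n"
    "set (leaf_colors r x) = insert alpha (set (pre_colors r) - {pre_colors r ! x})"
  using pre_colors_props[of r] assms n2 by (auto simp: leaf_colors_def length_remove1)

lemma colors_cases:
  assumes "g \<in> {1..n + d + 1}"
  obtains "g = alpha" | "g = beta" | "g \<in> {1..<n + d}" "g \<noteq> alpha" "g \<noteq> beta"
  using assms by (fastforce simp: alpha_def beta_def)

lemma vertex_cases:
  assumes "valid r" "length r \<le> d + 2"
  obtains (inner) "length r \<le> d"
    | (pre) x s where "r = x # s" "length s = d" "x < n" "valid s"
    | (leaf) y x s where "r = y # x # s" "length s = d" "y < n" "x < n" "valid s"
proof -
  consider "length r \<le> d" | "length r = Suc d" | "length r = Suc (Suc d)"
    using assms(2) by linarith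
  then show ?thesis
  proof cases
    case 1
    then show ?thesis by (rule inner)
  next
    case 2
    then show ?thesis using assms(1) by (auto simp: length_Suc_conv intro: pre)
  next
    case 3
    then show ?thesis using assms(1) by (auto simp: length_Suc_conv intro: leaf)
  qed
qed

lemma col_inner: "length r \<le> d \<Longrightarrow> col r = (if even (d - length r) then alpha else beta)"
  by (simp add: col_def)

lemma col_pre:
  assumes "length s = d" "x < n" "valid s"
  shows "col (x # s) = pre_colors s ! x" "col (x # s) \<in> set (pre_colors s)" "col (x # s) \<noteq> alpha"
  using assms pre_colors_props[of s] nth_mem[of x "pre_colors s"] by (auto simp: col_def simp del: nth_mem)

lemma col_leaf:
  assumes "length s = d" "x < n" "valid s" "y < n"
  shows "col (y # x # s) = leaf_colors s x ! y" "col (y # x # s) \<in> set (leaf_colors s x)"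
    "col (y # x # s) \<in> insert alpha (set (pre_colors s) - {col (x # s)})"
    "col (y # x # s) \<noteq> col (x # s)"
  using assms leaf_colors_props[of s x] col_pre[of s x] nth_mem[of y "leaf_colors s x"] by (auto simp: col_def)

lemma cdist_pre: "length s = d \<Longrightarrow> cdist (x # s) g =
    (if g = col (x # s) then 0 else if g = alpha \<or> g \<in> set (pre_colors s) then 1 else Suc (inner_dist s g))"
  by (simp add: cdist_def)

lemma cdist_leaf: "length s = d \<Longrightarrow> cdist (y # x # s) g =
    (if g = col (y # x # s) then 0 else if g = col (x # s) then 1
     else if g = alpha \<or> g \<in> set (pre_colors s) then 2 else Suc (Suc (inner_dist s g)))"
  by (simp add: cdist_def)

lemma cdist_inner: "length r \<le> d \<Longrightarrow> cdist r g =
    (if g = alpha then (if even (d - length r) then 0 else 1)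
     else if g = beta then (if even (d - length r) then 1 else 0) else inner_dist r g)"
  by (simp add: cdist_def)

section \<open>\<open>cdist\<close> as the distance to a color class\<close>

lemma cdist_eq_0_iff:
  assumes "valid r" "length r \<le> d + 2" "g \<in> {1..n + d + 1}"
  shows "cdist r g = 0 \<longleftrightarrow> col r = g"
  using assms(1,2)
proof (cases rule: vertex_cases)
  case inner
  have "inner_dist r g > 0" using inner_dist_ge[OF inner, of g] inner by linarith
  then show ?thesis using inner
    by (auto simp: cdist_inner col_inner alpha_def beta_def)
qed (auto simp: cdist_pre cdist_leaf)

lemma cdist_lipschitz:
  assumes "valid (x # r)" "length r < d + 2"
  shows "cdist (x # r) g \<le> cdist r g + 1 \<and> cdist r g \<le> cdist (x # r) g + 1"
proof -
  have "valid (x # r)" "length (x # r) \<le> d + 2" using assms by auto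
  then show ?thesis
  proof (cases rule: vertex_cases)
    case inner
    then show ?thesis using inner_dist_lipschitz[of x r g] assms
      by (auto simp: cdist_inner simp del: inner_dist.simps)
  next
    case (pre x' s)
    then show ?thesis using inner_dist_avail[of s g] pre_colors_props[of s] col_pre[of s x']
      by (auto simp: cdist_inner cdist_pre alpha_def beta_def)
  next
    case (leaf y x' s)
    then have "col (y # x' # s) \<in> insert alpha (set (pre_colors s))" using col_leaf(3) by blast
    then show ?thesis using leaf by (auto simp: cdist_leaf cdist_pre)
  qed
qed

text \<open>Downward steps serve the colors present below, upward steps the missing ones; from a
  leaf only the parent can be reached.\<close>

lemma cdist_descent:
  assumes "valid r" "length r \<le> d + 2" "g \<in> {1..n + d + 1}" "cdist r g > 0"
  shows "(r \<noteq> [] \<and> cdist r g = cdist (tl r) g + 1)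
    \<or> (\<exists>x<n. length r < d + 2 \<and> cdist r g = cdist (x # r) g + 1)"
  using assms(1,2)
proof (cases rule: vertex_cases)
  case inner
  have child: ?thesis if "x < n" "length r < d + 2" "cdist r g = cdist (x # r) g + 1" for x
    using that by blast
  have pre_child: ?thesis if "length r = d" "cdist r g = 1" "g \<in> set (pre_colors r)"
  proof -
    obtain x where "x < length (pre_colors r)" and g: "pre_colors r ! x = g"
      using \<open>g \<in> set (pre_colors r)\<close> unfolding in_set_conv_nth by blast
    then have "x < n" using pre_colors_props(2)[OF assms(1) that(1)] by simp
    then have "cdist (x # r) g = 0" using that g col_pre(1)[of r x] assms(1) by (simp add: cdist_pre)
    then show ?thesis using child[of x] that \<open>x < n\<close> by simp
  qed
  show ?thesis using assms(3)
  proof (cases rule: colors_cases)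
    case 1
    then have odd: "odd (d - length r)" using assms(4) inner by (auto simp: cdist_inner split: if_splits)
    then have "length r < d" by (cases "length r = d") (use inner in auto)
    moreover from this odd have "even (d - Suc (length r))"
      by (metis Suc_diff_Suc even_Suc)
    ultimately show ?thesis using child[of 0] n2 odd 1 by (auto simp: cdist_inner)
  next
    case 2
    then have ev: "even (d - length r)" using assms(4) inner pre_colors_props(6)
      by (auto simp: cdist_inner alpha_def beta_def split: if_splits)
    show ?thesis
    proof (cases "length r = d")
      case True
      then show ?thesis using pre_child 2 pre_colors_props[of r] assms(1) by (auto simp: cdist_inner)
    next
      case False
      then have "length r < d" using inner by simp
      moreover from this ev have "odd (d - Suc (length r))"
        by (metis Suc_diff_Suc even_Suc)
      ultimately show ?thesis using child[of 0] n2 ev 2 by (auto simp: cdist_inner alpha_def beta_def)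
    qed
  next
    case 3
    show ?thesis
    proof (cases "g \<in> set (avail r)")
      case g: True
      show ?thesis
      proof (cases "length r = d")
        case True
        then show ?thesis using pre_child 3 g pre_colors_props[of r] assms(1) inner_dist_avail[of r g]
          by (auto simp: cdist_inner)
      next
        case False
        then have len: "length r < d" using inner by simp
        \<comment> \<open>The children \<open>0\<close> and \<open>1\<close>, which exist by
          \<open>n \<ge> 2\<close>, pick different missing colors, so one of them keeps
          \<open>g\<close> available.\<close>
        have "avail r ! 0 \<noteq> avail r ! 1"
          using avail_props[of r] assms(1) inner nth_avail[of r 0] nth_avail[of r 1] len n2
          by (simp add: nth_eq_iff_index_eq)
        then obtain x where x: "x < n" "avail r ! x \<noteq> g" using n2
          by (metis Suc_1 Suc_le_lessD less_Suc_eq order_less_trans zero_less_one One_nat_def)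
        then have "g \<in> set (avail (x # r))" using g nth_avail[of r x] assms(1) len by auto
        then have "inner_dist r g = inner_dist (x # r) g + 1" using inner_dist_avail[of r g] g len by auto
        then show ?thesis using child[of x] x len 3 by (simp add: cdist_inner del: inner_dist.simps)
      qed
    next
      case False
      then obtain x s where r: "r = x # s" using 3 by (cases r) auto
      with False have "inner_dist r g = inner_dist s g + 1" by auto
      then show ?thesis using 3 inner r by (simp add: cdist_inner del: inner_dist.simps)
    qed
  qed
next
  case (pre x s)
  show ?thesis
  proof (cases "g = alpha \<or> g \<in> set (pre_colors s)")
    case True
    \<comment> \<open>The leaves below carry \<open>alpha\<close> and all of
      \<open>pre_colors s\<close> except the color of \<open>r\<close>, which is ruled out by the
      positive distance.\<close>
    then have "cdist r g = 1" "g \<in> set (leaf_colors s x)"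
      using pre assms(4) leaf_colors_props[of s x] col_pre[of s x] by (auto simp: cdist_pre split: if_splits)
    moreover obtain y where "y < n" "leaf_colors s x ! y = g"
      using calculation(2) leaf_colors_props[of s x] pre by (metis in_set_conv_nth)
    ultimately show ?thesis using pre col_leaf[of s x y] by (intro disjI2 exI[of _ y]) (auto simp: cdist_leaf)
  next
    case False
    then show ?thesis using pre assms(4) pre_colors_props[of s] by (auto simp: cdist_pre cdist_inner split: if_splits)
  qed
next
  case (leaf y x s)
  then show ?thesis using assms(4) by (auto simp: cdist_leaf cdist_pre split: if_splits)
qed

section \<open>Properness of the coloring\<close>

lemma col_Cons_neq:
  assumes "valid (x # r)" "length r < d + 2"
  shows "col (x # r) \<noteq> col r"
proof -
  have "valid (x # r)" "length (x # r) \<le> d + 2" using assms by auto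
  then show ?thesis
  proof (cases rule: vertex_cases)
    case inner
    then have "d - length r = Suc (d - length (x # r))" by auto
    then show ?thesis using inner by (simp add: col_inner alpha_def beta_def)
  next
    case (pre x' s)
    then show ?thesis using col_pre[of s x'] by (auto simp: col_inner)
  next
    case (leaf y x' s)
    then show ?thesis using col_leaf[of s x' y] by auto
  qed
qed

lemma col_range:
  assumes "valid r" "length r \<le> d + 2"
  shows "col r \<in> {1..n + d + 1}"
  using assms
proof (cases rule: vertex_cases)
  case inner
  then show ?thesis using n2 by (auto simp: col_inner alpha_def beta_def)
next
  case (pre x s)
  have "set (pre_colors s) \<subseteq> {1..n + d + 1}" using pre_colors_props[of s] avail_props[of s] pre n2
    by (auto simp: beta_def)
  then show ?thesis using col_pre[of s x] pre by blast
next
  case (leaf y x s)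
  have "set (pre_colors s) \<subseteq> {1..n + d + 1}" using pre_colors_props[of s] avail_props[of s] leaf n2
    by (auto simp: beta_def)
  then show ?thesis using col_leaf[of s x y] leaf n2 by (auto simp: alpha_def)
qed

section \<open>Distinct vertices have distinct codes\<close>

text \<open>At most \<open>d\<close> of the \<open>n + d - 1\<close> colors have been dropped, so by
  \<open>n \<ge> 2\<close> one survives. It serves as a probe for the depth of a vertex.\<close>

lemma ex_avail:
  assumes "valid r" "length r \<le> d"
  obtains g where "g \<in> set (avail r)" "g \<in> {1..<n + d}" "g \<noteq> alpha" "g \<noteq> beta"
proof -
  have "length (avail r) > 0" using avail_props[OF assms] assms n2 by auto
  then obtain g where "g \<in> set (avail r)" by (metis length_greater_0_conv list.set_sel(1))
  moreover from this have "g \<in> {1..<n + d}" using avail_props[OF assms] by auto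
  ultimately show ?thesis using that by (auto simp: alpha_def beta_def)
qed

text \<open>The common color can only be \<open>beta\<close>, which puts \<open>r\<close> strictly
  above depth \<open>d\<close>. Then every color below \<open>n + d\<close> is at distance at least
  2 from \<open>r\<close>, whereas \<open>x # s\<close> has one within distance 1.\<close>

lemma cdist_inner_neq_pre:
  assumes r: "valid r" "length r \<le> d" and s: "length s = d" "x < n" "valid s"
    and eq: "\<And>g. g \<in> {1..n + d + 1} \<Longrightarrow> cdist r g = cdist (x # s) g"
    and col: "col r = col (x # s)"
  shows False
proof -
  have odd: "odd (d - length r)"
    using col r col_pre[OF s] by (auto simp: col_inner split: if_splits)
  then have "length r < d" using r by (cases "length r = d") auto
  obtain g where g: "g \<in> set (avail s)" "g \<in> {1..<n + d}" "g \<noteq> alpha" "g \<noteq> beta"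
    using ex_avail[of s] s by auto
  then have "cdist (x # s) g \<le> 1" using s pre_colors_props[of s] by (auto simp: cdist_pre)
  moreover have "cdist r g \<ge> 2" using g r inner_dist_ge[of r g] \<open>length r < d\<close> by (auto simp: cdist_inner)
  ultimately show False using eq[of g] g by auto
qed

text \<open>A leaf has exactly one color at distance 1, that of its parent, but a vertex of depth
  \<open>d\<close> has two. Higher up, that single color must be \<open>beta\<close>, so
  \<open>r\<close> is colored \<open>alpha\<close> and lies at least two levels above depth
  \<open>d\<close>; then all colors below \<open>n + d\<close> are at distance at least 3, while a
  leaf has one within distance 2.\<close>

lemma cdist_inner_neq_leaf:
  assumes r: "valid r" "length r \<le> d" and s: "length s = d" "x < n" "valid s" "y < n"
    and eq: "\<And>g. g \<in> {1..n + d + 1} \<Longrightarrow> cdist r g = cdist (y # x # s) g"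
    and col: "col r = col (y # x # s)"
  shows False
proof (cases "length r = d")
  case True
  obtain g where g: "g \<in> set (avail r)" "g \<in> {1..<n + d}" "g \<noteq> alpha" "g \<noteq> beta"
    using ex_avail[OF r] by auto
  have one: "h = col (x # s)" if "cdist r h = 1" "h \<in> {1..n + d + 1}" for h
  proof -
    have "cdist (y # x # s) h = 1" using that eq by simp
    moreover have "cdist (y # x # s) h \<noteq> 1" if "h \<noteq> col (x # s)"
      unfolding cdist_leaf[OF s(1)] using that by simp
    ultimately show ?thesis by blast
  qed
  have "cdist r g = 1" using inner_dist_avail[of r g] g r True by (simp add: cdist_inner)
  moreover have "cdist r beta = 1" using True by (simp add: cdist_inner alpha_def beta_def)
  ultimately show False using one[of g] one[of beta] g n2 by (auto simp: beta_def)
next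
  case False
  then have len: "length r < d" using r by simp
  have big: "cdist r g \<ge> d + 1 - length r" if "g \<in> {1..<n + d}" for g
    using that inner_dist_ge[of r g] r by (auto simp: cdist_inner alpha_def beta_def)
  have c: "col (x # s) \<in> {1..n + d + 1}" using col_range[of "x # s"] s by auto
  have F1: "cdist (y # x # s) (col (x # s)) = 1" using s col_leaf[of s x y] by (auto simp: cdist_leaf)
  have cb: "col (x # s) = beta"
    using c
  proof (cases rule: colors_cases)
    case 3
    then show ?thesis using big[OF 3(1)] F1 eq[OF c] len by auto
  qed (use col_pre[of s x] s in auto)
  then have "col r = alpha"
    using col r col_leaf[of s x y] s by (auto simp: col_inner split: if_splits)
  then have "even (d - length r)" using r by (auto simp: col_inner alpha_def beta_def split: if_splits)
  then have "d - length r \<ge> 2" using len by (cases "d - length r = 1") auto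
  obtain g where g: "g \<in> set (avail s)" "g \<in> {1..<n + d}" "g \<noteq> alpha" "g \<noteq> beta"
    using ex_avail[of s] s by auto
  then have "cdist (y # x # s) g \<le> 2" using s pre_colors_props[of s] by (auto simp: cdist_leaf)
  then show False using big[of g] eq[of g] g \<open>d - length r \<ge> 2\<close> by auto
qed

text \<open>Depth \<open>d\<close> is colored \<open>alpha\<close> and depth \<open>d + 1\<close>
  never is, so \<open>alpha\<close> is at distance 1 from \<open>z # t\<close> but at distance 0 or
  2 from a leaf.\<close>

lemma cdist_pre_neq_leaf:
  assumes t: "length t = d" "z < n" "valid t" and s: "length s = d" "x < n" "valid s" "y < n"
    and eq: "\<And>g. g \<in> {1..n + d + 1} \<Longrightarrow> cdist (z # t) g = cdist (y # x # s) g"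
  shows False
proof -
  have "cdist (z # t) alpha = 1" using t col_pre[of t z] by (auto simp: cdist_pre)
  moreover have "cdist (y # x # s) alpha \<noteq> 1" using s col_pre[of s x] by (auto simp: cdist_leaf)
  ultimately show False using eq[of alpha] n2 by (auto simp: alpha_def)
qed

lemma cdist_inner_inj:
  assumes u: "valid u" "length u \<le> d" and v: "valid v" "length v \<le> d"
    and eq: "\<And>g. g \<in> {1..n + d + 1} \<Longrightarrow> cdist u g = cdist v g"
  shows "u = v"
proof -
  have h: "inner_dist u g = inner_dist v g" if "g \<in> {1..<n + d}" for g
    using eq[of g] that u v by (auto simp: cdist_inner alpha_def beta_def)
  obtain a where a: "a \<in> set (avail u)" "a \<in> {1..<n + d}" using ex_avail[OF u] by blast
  obtain b where b: "b \<in> set (avail v)" "b \<in> {1..<n + d}" using ex_avail[OF v] by blast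
  \<comment> \<open>An available color attains the least distance possible at its depth, so each of
    \<open>a\<close> and \<open>b\<close> bounds one length by the other.\<close>
  have "length u = length v"
    using inner_dist_avail[OF u(2) a(1)] inner_dist_avail[OF v(2) b(1)] h[OF a(2)] h[OF b(2)] inner_dist_ge[OF u(2), of b]
      inner_dist_ge[OF v(2), of a] u v by linarith
  then show ?thesis using inner_dist_inj u v h by blast
qed

text \<open>A missing color has inner distance at least 3 at depth \<open>d\<close>, hence at least
  5 from a leaf, so the threshold 2 detects availability.\<close>

lemma cdist_leaf_label:
  assumes s: "length s = d" "x < n" "valid s" "y < n" and g: "g \<in> {1..<n + d}"
  shows "cdist (y # x # s) g \<le> 2 \<longleftrightarrow> g \<in> set (avail s)"
    and "g \<notin> set (avail s) \<Longrightarrow> cdist (y # x # s) g = Suc (Suc (inner_dist s g))"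
proof -
  have in_pcs: "g \<in> set (pre_colors s) \<longleftrightarrow> g \<in> set (avail s)" "g \<noteq> alpha"
    using pre_colors_props(3)[OF s(3,1)] g by (auto simp: alpha_def beta_def)
  show *: "cdist (y # x # s) g = Suc (Suc (inner_dist s g))" if "g \<notin> set (avail s)"
  proof -
    have "g \<noteq> col (y # x # s)" "g \<noteq> col (x # s)"
      using that in_pcs col_leaf(3)[OF s] col_pre(2)[OF s(1-3)] by auto
    then show ?thesis using that in_pcs cdist_leaf[OF s(1)] by simp
  qed
  show "cdist (y # x # s) g \<le> 2 \<longleftrightarrow> g \<in> set (avail s)"
  proof (cases "g \<in> set (avail s)")
    case True
    then show ?thesis using in_pcs cdist_leaf[OF s(1), of y x g] by simp
  next
    case False
    then show ?thesis using * inner_dist_not_avail[of s g] s(1) g by simp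
  qed
qed

text \<open>Below depth \<open>d\<close> the entries of available colors depend on the position
  among the descendants. What survives in the code is which colors are available and how far the
  missing ones are, and this already fixes the path.\<close>

lemma inner_dist_eq_at_depth:
  assumes s: "length s = d" "valid s" and t: "length t = d" "valid t"
    and "\<And>g. g \<in> {1..<n + d} \<Longrightarrow> g \<in> set (avail s) \<longleftrightarrow> g \<in> set (avail t)"
    and "\<And>g. g \<in> {1..<n + d} \<Longrightarrow> g \<notin> set (avail s) \<Longrightarrow> inner_dist s g = inner_dist t g"
  shows "s = t"
  using assms inner_dist_inj[of s t] inner_dist_avail[of s] inner_dist_avail[of t] by (metis order_refl)

text \<open>The path to the parent is read off the missing colors; then the own color identifies the
  child, as \<open>pre_colors\<close> is distinct.\<close>

lemma cdist_pre_inj: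
  assumes s: "length s = d" "x < n" "valid s" and t: "length t = d" "y < n" "valid t"
    and eq: "\<And>g. g \<in> {1..n + d + 1} \<Longrightarrow> cdist (x # s) g = cdist (y # t) g"
    and col: "col (x # s) = col (y # t)"
  shows "x # s = y # t"
proof -
  have Fs: "cdist (x # s) g \<le> 1 \<longleftrightarrow> g \<in> set (avail s)" "g \<notin> set (avail s) \<Longrightarrow> cdist (x # s) g = Suc (inner_dist s g)"
    if "g \<in> {1..<n + d}" for g
    using that inner_dist_not_avail[of s g] pre_colors_props[of s] col_pre[OF s] s
    by (auto simp: cdist_pre alpha_def beta_def)
  have Ft: "cdist (y # t) g \<le> 1 \<longleftrightarrow> g \<in> set (avail t)" "g \<notin> set (avail t) \<Longrightarrow> cdist (y # t) g = Suc (inner_dist t g)"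
    if "g \<in> {1..<n + d}" for g
    using that inner_dist_not_avail[of t g] pre_colors_props[of t] col_pre[OF t] t
    by (auto simp: cdist_pre alpha_def beta_def)
  have "cdist (x # s) g = cdist (y # t) g" if "g \<in> {1..<n + d}" for g using eq that by auto
  then have "s = t"
    by (intro inner_dist_eq_at_depth[OF s(1,3) t(1,3)]) (metis Fs Ft Suc_inject)+
  moreover have "pre_colors s ! x = pre_colors s ! y"
    using col col_pre(1)[OF s] col_pre(1)[OF t] \<open>s = t\<close> by metis
  then have "x = y"
    using pre_colors_props(1,2)[OF s(3,1)] s(2) t(2) by (metis nth_eq_iff_index_eq)
  ultimately show ?thesis by simp
qed

lemma cdist_leaf_inj:
  assumes s: "length s = d" "x < n" "valid s" "y < n"
    and t: "length t = d" "z < n" "valid t" "w < n"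
    and eq: "\<And>g. g \<in> {1..n + d + 1} \<Longrightarrow> cdist (y # x # s) g = cdist (w # z # t) g"
    and col: "col (y # x # s) = col (w # z # t)"
  shows "y # x # s = w # z # t"
proof -
  \<comment> \<open>The color of the parent is the only one at distance 1 from a leaf.\<close>
  have c: "col (x # s) = col (z # t)"
    using eq[of "col (x # s)"] col_range[of "x # s"] s t col_leaf[OF s]
    by (auto simp: cdist_leaf split: if_splits)
  have "cdist (y # x # s) g = cdist (w # z # t) g" if "g \<in> {1..<n + d}" for g using eq that by auto
  then have st: "s = t"
    by (intro inner_dist_eq_at_depth[OF s(1,3) t(1,3)]) (metis cdist_leaf_label s t Suc_inject)+
  moreover have "pre_colors s ! x = pre_colors s ! z"
    using c col_pre(1)[OF s(1-3)] col_pre(1)[OF t(1-3)] st by metis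
  then have xz: "x = z"
    using pre_colors_props(1,2)[OF s(3,1)] s(2) t(2) by (metis nth_eq_iff_index_eq)
  moreover have "leaf_colors s x ! y = leaf_colors s x ! w"
    using col col_leaf(1)[OF s] col_leaf(1)[OF t] st xz by metis
  then have "y = w"
    using leaf_colors_props(1,2)[OF s(3,1,2)] s(4) t(4) by (metis nth_eq_iff_index_eq)
  ultimately show ?thesis by simp
qed

lemma cdist_inj:
  assumes u: "valid u" "length u \<le> d + 2" and v: "valid v" "length v \<le> d + 2"
    and eq: "\<And>g. g \<in> {1..n + d + 1} \<Longrightarrow> cdist u g = cdist v g"
  shows "u = v"
proof -
  \<comment> \<open>The own color is the position of the only zero in the code.\<close>
  have col: "col u = col v"
    using cdist_eq_0_iff[OF u, of "col u"] cdist_eq_0_iff[OF v, of "col u"] col_range[OF u] eq by auto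
  note sym = eq[symmetric] col[symmetric]
  show ?thesis
    using u
  proof (cases rule: vertex_cases)
    case inner
    show ?thesis
      using v
    proof (cases rule: vertex_cases)
      case inner': inner
      then show ?thesis using cdist_inner_inj u v inner eq by blast
    next
      case (pre x s)
      then show ?thesis using cdist_inner_neq_pre[of u s x] u inner eq col by blast
    next
      case (leaf y x s)
      then show ?thesis using cdist_inner_neq_leaf[of u s x y] u inner eq col by blast
    qed
  next
    case u': (pre z t)
    show ?thesis
      using v
    proof (cases rule: vertex_cases)
      case inner
      then show ?thesis using cdist_inner_neq_pre[of v t z] v u' sym by blast
    next
      case (pre x s)
      then show ?thesis using cdist_pre_inj[of t z s x] u' eq col by blast
    next
      case (leaf y x s)
      then show ?thesis using cdist_pre_neq_leaf[of t z s x y] u' eq by blast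
    qed
  next
    case u': (leaf w z t)
    show ?thesis
      using v
    proof (cases rule: vertex_cases)
      case inner
      then show ?thesis using cdist_inner_neq_leaf[of v t z w] v u' sym by blast
    next
      case (pre x s)
      then show ?thesis using cdist_pre_neq_leaf[of s x t z w] u' sym by blast
    next
      case (leaf y x s)
      then show ?thesis using cdist_leaf_inj[of t z w s x y] u' eq col by blast
    qed
  qed
qed

section \<open>The coloring is locating\<close>

lemma locating_coloring_nary_tree:
  "locating_coloring (nary_tree n (d + 2)) (n + d + 1) (col \<circ> rev)"
proof -
  let ?G = "nary_tree n (d + 2)"
  have V: "v \<in> verts ?G \<longleftrightarrow> length (rev v) \<le> d + 2 \<and> valid (rev v)" for v
    by (auto simp: verts_nary_tree)
  have adjD: "\<exists>x r. (rev u = x # r \<and> rev v = r \<or> rev v = x # r \<and> rev u = r)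
      \<and> valid (x # r) \<and> length r < d + 2" if "adj ?G u v" for u v
  proof -
    from that obtain x where uv: "u \<in> verts ?G" "v \<in> verts ?G" and x: "v = u @ [x] \<or> u = v @ [x]"
      unfolding adj_nary_tree by blast
    from x show ?thesis
    proof
      assume "v = u @ [x]"
      then show ?thesis using uv by (intro exI[of _ x] exI[of _ "rev u"]) (auto simp: verts_nary_tree)
    next
      assume "u = v @ [x]"
      then show ?thesis using uv by (intro exI[of _ x] exI[of _ "rev v"]) (auto simp: verts_nary_tree)
    qed
  qed
  have dist: "gdist_set ?G v (color_class ?G (col \<circ> rev) g) = enat (cdist (rev v) g)"
    if v: "v \<in> verts ?G" and g: "g \<in> {1..n + d + 1}" for v g
  proof (rule gdist_set_eqI[where V = "verts ?G"])
    show "u \<in> verts ?G \<and> w \<in> verts ?G" if "adj ?G u w" for u w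
      using that by (simp add: adj_nary_tree)
    show "cdist (rev w) g = 0 \<longleftrightarrow> w \<in> color_class ?G (col \<circ> rev) g" if "w \<in> verts ?G" for w
      using that cdist_eq_0_iff[of "rev w" g] g V by (auto simp: color_class_def)
    show "color_class ?G (col \<circ> rev) g \<subseteq> verts ?G" by (auto simp: color_class_def)
    show "cdist (rev u) g \<le> cdist (rev w) g + 1" if "adj ?G u w" for u w
      using adjD[OF that] cdist_lipschitz by metis
    show "\<exists>u. adj ?G w u \<and> cdist (rev w) g = cdist (rev u) g + 1" if w: "w \<in> verts ?G" "cdist (rev w) g > 0" for w
    proof -
      consider "rev w \<noteq> []" "cdist (rev w) g = cdist (tl (rev w)) g + 1"
        | x where "x < n" "length w < d + 2" "cdist (rev w) g = cdist (x # rev w) g + 1"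
        using cdist_descent[of "rev w" g] w g V by auto
      then show ?thesis
      proof cases
        case 1
        then obtain u x where "w = u @ [x]" by (cases w rule: rev_cases) auto
        then show ?thesis using 1 w V by (intro exI[of _ u]) (auto simp: adj_nary_tree)
      next
        case 2
        then show ?thesis using w V by (intro exI[of _ "w @ [x]"]) (auto simp: adj_nary_tree)
      qed
    qed
  qed (fact v)
  have "proper_coloring ?G (n + d + 1) (col \<circ> rev)"
    unfolding proper_coloring_def
  proof (intro conjI ballI impI subsetI)
    show "c \<in> {1..n + d + 1}" if "c \<in> (col \<circ> rev) ` verts ?G" for c
      using that col_range V by auto
    show "(col \<circ> rev) u \<noteq> (col \<circ> rev) w" if "adj ?G u w" for u w
      using adjD[OF that] col_Cons_neq unfolding comp_def by metis
  qed
  moreover have "inj_on (color_code ?G (n + d + 1) (col \<circ> rev)) (verts ?G)"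
  proof (rule inj_onI)
    fix u w assume "u \<in> verts ?G" "w \<in> verts ?G"
      "color_code ?G (n + d + 1) (col \<circ> rev) u = color_code ?G (n + d + 1) (col \<circ> rev) w"
    then have "rev u = rev w"
      using cdist_inj[of "rev u" "rev w"] V dist by (auto simp: color_code_eq_iff)
    then show "u = w" by simp
  qed
  ultimately show ?thesis by (simp add: locating_coloring_def)
qed

end

section \<open>The counting bound\<close>

lemma relpowp_nary_tree_append:
  "w @ u \<in> verts (nary_tree n k) \<Longrightarrow> (adj (nary_tree n k) ^^ length u) w (w @ u)"
proof (induction u rule: rev_induct)
  case (snoc x u)
  then have "w @ u \<in> verts (nary_tree n k)" by (auto simp: verts_nary_tree)
  moreover from this snoc.prems have "adj (nary_tree n k) (w @ u) (w @ u @ [x])"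
    by (auto simp: adj_nary_tree)
  ultimately show ?case using snoc.IH by auto
qed simp

lemma relpowp_sym:
  assumes "(R ^^ l) u v" "\<And>x y. R x y \<Longrightarrow> R y x"
  shows "(R ^^ l) v u"
  using assms(1)
proof (induction l arbitrary: v)
  case (Suc l)
  then show ?case using assms(2) by (metis relpowp_Suc_E relpowp_Suc_I2)
qed simp

lemma gdist_nary_tree_le:
  assumes "u \<in> verts (nary_tree n k)" "v \<in> verts (nary_tree n k)"
  shows "gdist (nary_tree n k) u v \<le> enat (2 * k)"
proof -
  have "(adj (nary_tree n k) ^^ length u) u []"
    by (rule relpowp_sym) (use relpowp_nary_tree_append[of "[]" u n k] assms(1) adj_sym in auto)
  moreover have "(adj (nary_tree n k) ^^ length v) [] v"
    using relpowp_nary_tree_append[of "[]" v] assms(2) by auto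
  ultimately have "(adj (nary_tree n k) ^^ (length u + length v)) u v"
    by (auto simp: relpowp_add)
  then have "gdist (nary_tree n k) u v \<le> enat (length u + length v)" by (rule gdist_le)
  also have "\<dots> \<le> enat (2 * k)" using assms by (auto simp: verts_nary_tree)
  finally show ?thesis .
qed

lemma gdist_set_nary_tree_bounded:
  assumes "v \<in> verts (nary_tree n k)" "C \<subseteq> verts (nary_tree n k)"
  shows "gdist_set (nary_tree n k) v C \<in> insert \<infinity> (enat ` {..2 * k})"
proof (cases "C = {}")
  case False
  then obtain x where "x \<in> C" by auto
  then have "gdist_set (nary_tree n k) v C \<le> enat (2 * k)"
    unfolding gdist_set_def using assms gdist_nary_tree_le by (intro INF_lower2[of x]) auto
  then show ?thesis by (cases "gdist_set (nary_tree n k) v C") auto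
qed (simp add: gdist_set_def top_enat_def)

lemma gdist_set_eq_0: "x \<in> C \<Longrightarrow> gdist_set G x C = 0"
  unfolding gdist_set_def by (metis INF_lower gdist_eq_0_iff le_zero_eq)

lemma gdist_set_eq_0_iff: "gdist_set G x C = 0 \<longleftrightarrow> x \<in> C"
proof
  assume "gdist_set G x C = 0"
  then have "gdist_set G x C < 1" by simp
  then obtain y where "y \<in> C" "gdist G x y < 1" unfolding gdist_set_def INF_less_iff by auto
  then show "x \<in> C" using gdist_eq_0_iff[of G x y] by (simp add: one_eSuc)
qed (rule gdist_set_eq_0)

section \<open>Leaves with a common parent\<close>

lemma leaf_walk:
  assumes "length w = k" "(adj (nary_tree n k) ^^ l) w v" "v \<noteq> w"
  shows "\<exists>l'. l = Suc l' \<and> (adj (nary_tree n k) ^^ l') (butlast w) v"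
proof (cases l)
  case (Suc l')
  then obtain u where u: "adj (nary_tree n k) w u" "(adj (nary_tree n k) ^^ l') u v"
    using assms(2) by (metis relpowp_Suc_D2)
  then have "u = butlast w" using assms(1) by (auto simp: adj_nary_tree verts_nary_tree)
  with u Suc show ?thesis by auto
qed (use assms in auto)

text \<open>A walk from a leaf to another vertex first visits the parent, and the sibling can take
  over from there at no extra cost.\<close>

lemma gdist_sibling_leaves:
  assumes p: "Suc (length p) = k" and V: "p @ [i] \<in> verts (nary_tree n k)" "p @ [j] \<in> verts (nary_tree n k)"
    and v: "v \<noteq> p @ [i]"
  shows "gdist (nary_tree n k) (p @ [j]) v \<le> gdist (nary_tree n k) (p @ [i]) v"
  unfolding gdist_def[of _ "p @ [i]"]
proof (rule INF_greatest)
  fix l assume "l \<in> {l. (adj (nary_tree n k) ^^ l) (p @ [i]) v}"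
  then obtain l' where l: "l = Suc l'" "(adj (nary_tree n k) ^^ l') p v"
    using leaf_walk[where w = "p @ [i]" and v = v and l = l and n = n] p v by auto
  have "adj (nary_tree n k) (p @ [j]) p" using V by (auto simp: adj_nary_tree verts_nary_tree)
  with l have "(adj (nary_tree n k) ^^ l) (p @ [j]) v" by (metis relpowp_Suc_I2)
  then show "gdist (nary_tree n k) (p @ [j]) v \<le> enat l" by (rule gdist_le)
qed

text \<open>Equally colored sibling leaves would share a code: entry 0 at their color, and equal
  distances to all other classes, since neither leaf lies in them.\<close>

lemma sibling_leaves_color:
  assumes loc: "locating_coloring (nary_tree n k) m c" and p: "Suc (length p) = k"
    and V: "p @ [i] \<in> verts (nary_tree n k)" "p @ [j] \<in> verts (nary_tree n k)"
    and eq: "c (p @ [i]) = c (p @ [j])"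
  shows "i = j"
proof -
  let ?G = "nary_tree n k"
  have le: "gdist_set ?G (p @ [j]) (color_class ?G c g) \<le> gdist_set ?G (p @ [i]) (color_class ?G c g)"
    if "p @ [i] \<in> verts ?G" "p @ [j] \<in> verts ?G" "c (p @ [i]) = c (p @ [j])" for g i j
  proof (cases "g = c (p @ [j])")
    case True
    then have "gdist_set ?G (p @ [j]) (color_class ?G c g) = 0"
      using that by (intro gdist_set_eq_0) (auto simp: color_class_def)
    then show ?thesis by simp
  next
    case False
    then have "p @ [i] \<notin> color_class ?G c g" using that by (auto simp: color_class_def)
    then show ?thesis
      unfolding gdist_set_def using gdist_sibling_leaves[OF p that(1,2)] by (intro INF_mono) metis
  qed
  have "color_code ?G m c (p @ [i]) = color_code ?G m c (p @ [j])"
    unfolding color_code_eq_iff using le[OF V eq] le[OF V(2,1) eq[symmetric]] by (auto intro: antisym)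
  then show ?thesis using loc V by (auto simp: locating_coloring_def inj_on_def)
qed

text \<open>A vertex \<open>p\<close> of depth \<open>k - 1\<close> sees \<open>n\<close> colors at distance \<open>1\<close>, so its color code is
  determined by the at most \<open>m - n\<close> pairs (color, distance) with distance other than \<open>1\<close>.\<close>

lemma pre_leaf_counting:
  assumes loc: "locating_coloring (nary_tree n k) m c" and k: "k \<ge> 1" and mn: "m \<le> n + q"
  shows "n ^ (k - 1) \<le> (m * (2 * k + 2)) ^ q"
proof -
  let ?G = "nary_tree n k"
  define P where "P = {w. set w \<subseteq> {..<n} \<and> length w = k - 1}"
  define D where "D p g = gdist_set ?G p (color_class ?G c g)" for p g
  define E where "E p = {(g, D p g) | g. g \<in> {1..m} \<and> D p g \<noteq> 1}" for p
  \<comment> \<open>Each of the \<open>m\<close> colors is paired with one of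
    \<open>2 * k + 1\<close> finite distances or with \<open>\<infinity>\<close>, the entry of an
    empty class.\<close>
  define U where "U = {1..m} \<times> insert \<infinity> (enat ` {..2 * k})"
  \<comment> \<open>Lists of fixed length encode the sets of at most \<open>q\<close> pairs and are
    counted by a plain power.\<close>
  define Q where "Q = {xs. set xs \<subseteq> U \<and> length xs = q}"
  have proper: "\<And>u. u \<in> verts ?G \<Longrightarrow> c u \<in> {1..m}"
    "\<And>u v. adj ?G u v \<Longrightarrow> c u \<noteq> c v"
    using loc by (auto simp: locating_coloring_def proper_coloring_def adj_nary_tree)
  have PV: "p \<in> verts ?G" if "p \<in> P" for p
    using that k by (auto simp: P_def verts_nary_tree)
  have finU: "finite U" and cardU: "card U = m * (2 * k + 2)"
  proof -
    have "card (enat ` {..2 * k}) = 2 * k + 1" by (subst card_image) (auto simp: inj_on_def)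
    then show "finite U" "card U = m * (2 * k + 2)"
      by (auto simp: U_def card_cartesian_product card_insert_if)
  qed
  have E_sub: "E p \<subseteq> U" if "p \<in> P" for p
    using gdist_set_nary_tree_bounded[OF PV[OF that]]
    by (auto simp: E_def U_def D_def color_class_def subset_iff)
  have E_code: "\<exists>xs \<in> Q. set xs = E p" if p: "p \<in> P" for p
  proof -
    let ?L = "(\<lambda>i. c (p @ [i])) ` {..<n}"
    have child: "p @ [i] \<in> verts ?G" if "i < n" for i
      using p that k by (auto simp: P_def verts_nary_tree)
    have adj: "adj ?G p (p @ [i])" if "i < n" for i
      using PV[OF p] child[OF that] by (auto simp: adj_nary_tree)
    have "inj_on (\<lambda>i. c (p @ [i])) {..<n}"
      using sibling_leaves_color[OF loc, of p] child p k by (auto simp: inj_on_def P_def)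
    then have cardL: "card ?L = n" by (simp add: card_image)
    have L: "D p g = 1" if "g \<in> ?L" for g
    proof -
      from that obtain i where i: "i < n" "g = c (p @ [i])" by auto
      have "gdist ?G p (p @ [i]) \<le> enat 1" using adj[OF i(1)] by (intro gdist_le) auto
      then have "D p g \<le> 1"
        unfolding D_def gdist_set_def using child[OF i(1)] i
        by (intro INF_lower2[of "p @ [i]"]) (auto simp: color_class_def one_enat_def)
      moreover have "D p g \<noteq> 0"
        using proper(2)[OF adj[OF i(1)]] i by (auto simp: D_def gdist_set_eq_0_iff color_class_def)
      ultimately show ?thesis by (metis ileI1 iless_Suc_eq one_eSuc antisym zero_less_iff_neq_zero)
    qed
    have L_sub: "?L \<subseteq> {1..m}" using proper(1) child by auto
    have "E p \<subseteq> (\<lambda>g. (g, D p g)) ` ({1..m} - ?L)" using L by (auto simp: E_def)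
    then have "card (E p) \<le> card ({1..m} - ?L)" by (intro surj_card_le) auto
    moreover have "card ({1..m} - ?L) = m - n"
      using L_sub cardL by (simp add: card_Diff_subset finite_subset)
    ultimately have cardE: "card (E p) \<le> q"
      using mn by simp
    have "D p (c p) = 0" using PV[OF p] by (auto simp: D_def gdist_set_eq_0_iff color_class_def)
    then have ne: "(c p, 0) \<in> E p" using proper(1)[OF PV[OF p]] by (auto simp: E_def)
    have "finite (E p)" using E_sub[OF p] finU finite_subset by blast
    then obtain ys where ys: "set ys = E p" "length ys = card (E p)"
      by (metis finite_distinct_list distinct_card)
    \<comment> \<open>Repeating the pair of the own color pads the list to length \<open>q\<close>
      without changing its set.\<close>
    have "set (ys @ replicate (q - card (E p)) (c p, 0)) = E p"
      using ys(1) ne by (simp add: set_replicate_conv_if insert_absorb)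
    moreover have "ys @ replicate (q - card (E p)) (c p, 0) \<in> Q"
      using calculation E_sub[OF p] ys cardE unfolding Q_def by auto
    ultimately show ?thesis by blast
  qed
  have "inj_on E P"
  proof (rule inj_onI)
    fix p p' assume pp: "p \<in> P" "p' \<in> P" and eq: "E p = E p'"
    have "D p g = D p' g" if g: "g \<in> {1..m}" for g
    proof -
      \<comment> \<open>A color without a pair in \<open>E w\<close> has entry \<open>1\<close>, so
        \<open>E w\<close> retains the whole code.\<close>
      have "(g, v) \<in> E w \<longleftrightarrow> v = D w g \<and> v \<noteq> 1" for v w
        using g by (auto simp: E_def)
      then show ?thesis using eq by metis
    qed
    then have "color_code ?G m c p = color_code ?G m c p'"
      by (auto simp: color_code_eq_iff D_def)
    then show "p = p'" using loc PV pp by (auto simp: locating_coloring_def inj_on_def)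
  qed
  then have "card P = card (E ` P)" by (simp add: card_image)
  also have "\<dots> \<le> card (set ` Q)"
  proof (rule card_mono)
    show "finite (set ` Q)" using finU by (simp add: Q_def finite_lists_length_eq)
    show "E ` P \<subseteq> set ` Q" using E_code by fastforce
  qed
  also have "\<dots> \<le> card Q"
    using finU by (intro card_image_le) (auto simp: Q_def finite_lists_length_eq)
  also have "\<dots> = card U ^ q" unfolding Q_def using finU by (rule card_lists_length_eq)
  finally show ?thesis using card_lists_length_eq[of "{..<n}" "k - 1"] by (simp add: P_def cardU)
qed

text \<open>Here \<open>m = n + k - 2 \<le> 2 * n\<close> and \<open>q = k - 2\<close>, so there are
  at most \<open>n ^ (k - 2)\<close> codes times a factor that depends only on \<open>k\<close>.
  Once \<open>n\<close> exceeds this factor, they are fewer than the \<open>n ^ (k - 1)\<close>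
  vertices of depth \<open>k - 1\<close>.\<close>

lemma no_locating_coloring:
  assumes k: "k \<ge> 2" and n: "n \<ge> k" "n > (4 * k + 4) ^ (k - 2)"
  shows "\<not> locating_coloring (nary_tree n k) (n + k - 2) c"
proof
  assume "locating_coloring (nary_tree n k) (n + k - 2) c"
  then have "n ^ (k - 1) \<le> ((n + k - 2) * (2 * k + 2)) ^ (k - 2)"
    using k by (intro pre_leaf_counting) auto
  also have "\<dots> \<le> (n * (4 * k + 4)) ^ (k - 2)"
  proof (rule power_mono)
    have "(n + k - 2) * (2 * k + 2) \<le> (2 * n) * (2 * k + 2)" using n by (intro mult_right_mono) auto
    then show "(n + k - 2) * (2 * k + 2) \<le> n * (4 * k + 4)" by (simp add: algebra_simps)
  qed simp
  also have "\<dots> = n ^ (k - 2) * (4 * k + 4) ^ (k - 2)" by (rule power_mult_distrib)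
  also have "\<dots> < n ^ (k - 2) * n" using n k by (intro mult_strict_left_mono) auto
  also have "\<dots> = n ^ (k - 1)" using k by (metis Suc_1 Suc_diff_Suc Suc_le_lessD power_Suc2 diff_Suc_Suc One_nat_def)
  finally show False by simp
qed

section \<open>Finitely many exceptional \<open>n\<close>\<close>

theorem theorem2:
  fixes k :: nat
  assumes "k \<ge> 4"
  shows "finite {n. n \<ge> 2 \<and> \<chi>\<^sub>L (nary_tree n k) \<noteq> n + k - 1} \<and>
         finite {n. n \<ge> 2 \<and> \<chi>\<^sub>L (nary_tree n k) < n + k - 1}"
proof -
  \<comment> \<open>Beyond \<open>N\<close> both size conditions of
    \<open>no_locating_coloring\<close> hold.\<close>
  define N where "N = max k ((4 * k + 4) ^ (k - 2))"
  have eq: "\<chi>\<^sub>L (nary_tree n k) = n + k - 1" if "n \<ge> 2" "n > N" for n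
    unfolding locating_chromatic_number_def
  proof (rule Least_equality)
    interpret level_tree n "k - 2" using that by unfold_locales
    have "k - 2 + 2 = k" "n + (k - 2) + 1 = n + k - 1" using assms by auto
    then show "\<exists>c. locating_coloring (nary_tree n k) (n + k - 1) c"
      using locating_coloring_nary_tree by metis
    show "n + k - 1 \<le> l" if "\<exists>c. locating_coloring (nary_tree n k) l c" for l
    proof (rule ccontr)
      assume "\<not> n + k - 1 \<le> l"
      then have "l \<le> n + k - 2" by simp
      with that obtain c where "locating_coloring (nary_tree n k) (n + k - 2) c"
        using locating_coloring_mono by blast
      then show False using no_locating_coloring[of k n c] assms \<open>n > N\<close> by (auto simp: N_def)
    qed
  qed
  then have "{n. n \<ge> 2 \<and> \<chi>\<^sub>L (nary_tree n k) \<noteq> n + k - 1} \<subseteq> {..N}"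
    by (auto simp: not_le[symmetric])
  then have "finite {n. n \<ge> 2 \<and> \<chi>\<^sub>L (nary_tree n k) \<noteq> n + k - 1}"
    by (rule finite_subset) simp
  then show ?thesis
    by (auto elim: rev_finite_subset)
qed

end
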